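(* Let $\beta>0$. The collection of all price complex cells constitutes a polyhedral complex of dimension $\dim X$, and the $(\dim X)$-dimensional cells are closures of unique pattern regions, i.e. they are of the form $\overline{X}(A;\beta)$ for some feasible pattern $A\in\mathcal{A}^\beta$.
   Context: Setting: $S,W,H$ are positive integers with $H>1$, $[S]=\{1,\dots,S\}$, $[W]=\{1,\dots,W\}$, and $X\subset\mathbb{R}^{W\times H}$ is a non-empty polytope. For $s\in[S]$, $w\in[W]$ one is given $E_{sw}\in\mathbb{R}_{\ge 0}^H$ and $R_{sw}\in\mathbb{R}$. For $x=(x_w)_{w\in[W]}\in X$ put $\theta_{sw}(x)=\langle E_{sw},x_w\rangle$, $V_{sw}(x)=\theta_{sw}(x)-R_{sw}$ for $w\in[W]$, and $V_{s0}(x)=0$. $\Delta_{W+1}$ is the standard simplex $\{y\in\mathbb{R}_{\ge0}^{W+1}:\sum_{w=0}^W y_w=1\}$. Quadratic response: for $\beta>0$, $y^{quad}_s(x;\beta)\in\Delta_{W+1}$ is the unique minimizer over $y\in\Delta_{W+1}$ of $\sum_{w=0}^W \big(V_{sw}(x)y_w+\tfrac1\beta y_w^2\big)$ (the Euclidean projection of $-\tfrac\beta2 V_s(x)$ on $\Delta_{W+1}$). Patterns and cells: a pattern is a matrix $A\in\{0,1\}^{S\times(W+1)}$ (columns indexed by $0,\dots,W$). The unique pattern region of $A$ is $X(A;\beta)=\{x\in X: \text{for all } s\in[S],\,w\in\{0,\dots,W\},\ y^{quad}_{sw}(x;\beta)>0 \iff A_{sw}=1\}$, and $\overline{X}(A;\beta)$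 is its closure. $A$ is feasible if $\overline{X}(A;\beta)\ne\varnothing$; $\mathcal{A}^\beta$ is the set of feasible patterns. A price complex cell is a non-empty set $P\subseteq X$ of the form $P=\bigcap_{1\le i\le k}\overline{X}(A^i;\beta)$ with $k\ge1$ and $A^1,\dots,A^k\in\mathcal{A}^\beta$. "Polyhedral complex" is meant in the standard sense of polyhedral geometry.
   Formalization: The price complex cells alone need not be closed under faces (e.g. all E = 0, R = 0, X a segment), so the polyhedral complex consists of the cells together with all their faces; every added face is shown to lie in the relative boundary of X. *)

theory Defs
  imports "HOL-Analysis.Analysis"
begin

text \<open>
  The finite index sets $[S]$, $[W]$ and $[H]$ are finite types \<open>'s\<close>, \<open>'w\<close> and \<open>'h\<close>.
  The columns $0, 1, \dots, W$ are indexed by \<^typ>\<open>'w option\<close>, where \<^const>\<open>None\<close> is column $0$.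
  A matrix $x \in \mathbb{R}^{W \times H}$ is a vector of rows, so \<open>x $ w\<close> is $x_w$.
\<close>

definition disutility ::
  "('s \<Rightarrow> 'w \<Rightarrow> real^'h) \<Rightarrow> ('s \<Rightarrow> 'w \<Rightarrow> real) \<Rightarrow> real^'h::finite^'w::finite \<Rightarrow> 's \<Rightarrow> 'w option \<Rightarrow> real"
  where "disutility E R x s w = (case w of None \<Rightarrow> 0 | Some v \<Rightarrow> E s v \<bullet> (x $ v) - R s v)"

definition std_simplex :: "(real^'n::finite) set"
  where "std_simplex = {y. (\<forall>i. 0 \<le> y $ i) \<and> (\<Sum>i\<in>UNIV. y $ i) = 1}"

definition quad_response ::
  "('s \<Rightarrow> 'w \<Rightarrow> real^'h) \<Rightarrow> ('s \<Rightarrow> 'w \<Rightarrow> real) \<Rightarrow> real \<Rightarrow> real^'h::finite^'w::finite \<Rightarrow> 's \<Rightarrow> real^'w option"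
  where "quad_response E R \<beta> x s =
    (THE y. is_arg_min (\<lambda>y. \<Sum>w\<in>UNIV. disutility E R x s w * y $ w + 1 / \<beta> * (y $ w)\<^sup>2)
                       (\<lambda>y. y \<in> std_simplex) y)"

text \<open>A 0/1 matrix is a Boolean function of the row and column index; true stands for the entry 1.\<close>

type_synonym ('s, 'w) pattern = "'s \<Rightarrow> 'w option \<Rightarrow> bool"

definition pattern_region ::
  "('s \<Rightarrow> 'w \<Rightarrow> real^'h) \<Rightarrow> ('s \<Rightarrow> 'w \<Rightarrow> real) \<Rightarrow> (real^'h::finite^'w::finite) set \<Rightarrow> real
    \<Rightarrow> ('s, 'w) pattern \<Rightarrow> (real^'h^'w) set"
  where "pattern_region E R X \<beta> A = {x\<in>X. \<forall>s w. quad_response E R \<beta> x s $ w > 0 \<longleftrightarrow> A s w}"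

definition feasible_patterns ::
  "('s \<Rightarrow> 'w \<Rightarrow> real^'h) \<Rightarrow> ('s \<Rightarrow> 'w \<Rightarrow> real) \<Rightarrow> (real^'h::finite^'w::finite) set \<Rightarrow> real
    \<Rightarrow> ('s, 'w) pattern set"
  where "feasible_patterns E R X \<beta> = {A. closure (pattern_region E R X \<beta> A) \<noteq> {}}"

definition price_cells ::
  "('s \<Rightarrow> 'w \<Rightarrow> real^'h) \<Rightarrow> ('s \<Rightarrow> 'w \<Rightarrow> real) \<Rightarrow> (real^'h::finite^'w::finite) set \<Rightarrow> real
    \<Rightarrow> (real^'h^'w) set set"
  where "price_cells E R X \<beta> =
    {P. P \<noteq> {} \<and> P \<subseteq> X \<and>
        (\<exists>(k::nat) A. 1 \<le> k \<and> (\<forall>i\<in>{1..k}. A i \<in> feasible_patterns E R X \<beta>) \<and>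
           P = (\<Inter>i\<in>{1..k}. closure (pattern_region E R X \<beta> (A i))))}"

text \<open>As in \<^const>\<open>simplicial_complex\<close>, the empty set counts as a face.\<close>

definition polyhedral_complex :: "'a::euclidean_space set set \<Rightarrow> bool"
  where "polyhedral_complex C \<longleftrightarrow>
    finite C \<and>
    (\<forall>P\<in>C. polyhedron P) \<and>
    (\<forall>P\<in>C. \<forall>F. F face_of P \<longrightarrow> F \<in> C) \<and>
    (\<forall>P\<in>C. \<forall>Q\<in>C. (P \<inter> Q) face_of P \<and> (P \<inter> Q) face_of Q)"

definition complex_dim :: "'a::euclidean_space set set \<Rightarrow> int"
  where "complex_dim C = Max (aff_dim ` C)"

text \<open>
  The price complex cells alone are not closed under taking faces at the boundary of $X$: if, say,
  all \<open>E s w\<close> vanish, then the response does not depend on $x$, so $X$ is the only cell, whereas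
  the proper faces of $X$ are not cells. The collection is therefore completed with the
  faces of its members before it is called a polyhedral complex; that this only adds
  sets in the relative boundary of $X$ is part of the theorem.
\<close>

definition with_faces :: "'a::euclidean_space set set \<Rightarrow> 'a set set"
  where "with_faces C = C \<union> {F. \<exists>P\<in>C. F face_of P}"

end

theory Submission
  imports Defs
begin

text \<open>
  The optimality conditions give \<open>y\<^sub>w = \<beta>/2 \<cdot> max 0 (\<lambda> - V\<^sub>w)\<close>, where the multiplier \<open>\<lambda>\<close> is fixed by
  \<open>\<Sum>y = 1\<close>. For a prescribed support \<open>\<lambda>\<close> is affine in \<open>x\<close>, so the closure of a non-empty pattern
  region is the polytope cut out of \<open>X\<close> by \<open>V\<^sub>w \<le> \<lambda>\<close> on the support and \<open>V\<^sub>w \<ge> \<lambda>\<close> off it, and two such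
  polytopes meet in the common face where the constraints on which they disagree are tight. Thus
  \<open>X\<close> is covered by finitely many polyhedra that meet face to face, and the remaining claims hold
  for the intersections of members of any such cover.
\<close>

section \<open>Face-to-face covers by polyhedra\<close>

locale face_to_face_cover =
  fixes X :: "'a::euclidean_space set" and \<C> :: "'a set set"
  assumes finite_cover: "finite \<C>"
    and Union_cover: "\<Union>\<C> = X"
    and polyhedron_cover: "C \<in> \<C> \<Longrightarrow> polyhedron C"
    and face_cover: "C \<in> \<C> \<Longrightarrow> D \<in> \<C> \<Longrightarrow> (C \<inter> D) face_of C"
    and convex_X: "convex X"
    and closed_X: "closed X"
    and X_nonempty: "X \<noteq> {}"
begin

definition cells :: "'a set set"
  where "cells = {P. P \<noteq> {} \<and> (\<exists>\<D>. \<D> \<noteq> {} \<and> \<D> \<subseteq> \<C> \<and> P = \<Inter>\<D>)}"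

lemma cellE:
  assumes "P \<in> cells"
  obtains \<D> where "\<D> \<noteq> {}" "\<D> \<subseteq> \<C>" "P = \<Inter>\<D>" "P \<noteq> {}"
  using assms unfolding cells_def by blast

lemma cell_subset: "P \<in> cells \<Longrightarrow> P \<subseteq> X"
  using Union_cover by (fastforce elim!: cellE)

lemma cover_subset_cells: "C \<in> \<C> \<Longrightarrow> C \<noteq> {} \<Longrightarrow> C \<in> cells"
  unfolding cells_def by (auto intro!: exI[of _ "{C}"])

lemma finite_cells: "finite cells"
proof (rule finite_subset)
  show "cells \<subseteq> Inter ` Pow \<C>" unfolding cells_def by blast
  show "finite (Inter ` Pow \<C>)" using finite_cover by simp
qed

lemma polyhedron_cell: "P \<in> cells \<Longrightarrow> polyhedron P"
  by (metis cellE finite_cover finite_subset polyhedron_Inter polyhedron_cover subsetD)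

lemma convex_cell: "P \<in> cells \<Longrightarrow> convex P"
  by (simp add: polyhedron_cell polyhedron_imp_convex)

text \<open>Since \<open>P\<close> lies inside some member \<open>D\<close>, slicing the face
  \<open>D \<inter> C\<close> of \<open>D\<close> with the convex set \<open>P\<close> gives a face
  of \<open>D \<inter> P = P\<close>.\<close>

lemma cell_Int_cover_face:
  assumes "P \<in> cells" "C \<in> \<C>"
  shows "(P \<inter> C) face_of P"
proof -
  obtain \<D> D where D: "\<D> \<subseteq> \<C>" "P = \<Inter>\<D>" "D \<in> \<D>"
    using assms(1) by (auto elim!: cellE)
  then have "(D \<inter> C) \<inter> P face_of D \<inter> P"
    using face_cover assms convex_cell by (intro face_of_slice) auto
  moreover have "D \<inter> P = P" "(D \<inter> C) \<inter> P = P \<inter> C"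
    using D by auto
  ultimately show ?thesis by simp
qed

lemma cell_Int_face:
  assumes "P \<in> cells" "Q \<in> cells"
  shows "(P \<inter> Q) face_of P"
proof -
  obtain \<D> where D: "\<D> \<noteq> {}" "\<D> \<subseteq> \<C>" "Q = \<Inter>\<D>"
    using assms(2) by (auto elim!: cellE)
  have "\<Inter>((\<inter>) P ` \<D>) face_of P"
    using D assms(1) cell_Int_cover_face by (intro face_of_Inter) auto
  moreover have "\<Inter>((\<inter>) P ` \<D>) = P \<inter> Q" using D by auto
  ultimately show ?thesis by simp
qed

lemma cover_Int_cell_face:
  assumes "P \<in> cells" "C \<in> \<C>" "C \<noteq> {}"
  shows "(C \<inter> P) face_of C"
  using assms cell_Int_face cover_subset_cells by blast

text \<open>Near a point only those members of the cover matter that contain it, since they are closed.\<close>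

lemma extend_segment_in_cover:
  assumes x: "x \<in> rel_interior X" and z: "z \<in> X" "z \<noteq> x"
  obtains C y where "C \<in> \<C>" "x \<in> C" "y \<in> C" "x \<in> open_segment z y"
proof -
  obtain e where e: "e > 0" "ball x e \<inter> affine hull X \<subseteq> X" and xX: "x \<in> X"
    using x by (auto simp: mem_rel_interior_ball)
  define U where "U = \<Union>{C \<in> \<C>. x \<notin> C}"
  have "closed U" unfolding U_def
    using finite_cover polyhedron_cover polyhedron_imp_closed by (intro closed_Union) auto
  then have "open (- U)" "x \<in> - U" by (auto simp: U_def)
  then obtain d where d: "d > 0" "ball x d \<subseteq> - U"
    by (metis open_contains_ball)
  \<comment> \<open>This length puts \<open>y\<close> at distance \<open>min d e / 2\<close> from
    \<open>x\<close>: the radius \<open>e\<close> keeps it in \<open>X\<close>, the radius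
    \<open>d\<close> keeps it away from all members that miss \<open>x\<close>.\<close>
  define t where "t = min d e / (2 * norm (x - z))"
  have nz: "norm (x - z) > 0" using z by simp
  have t: "t > 0" using d e nz by (simp add: t_def)
  define y where "y = x + t *\<^sub>R (x - z)"
  have "dist x y = min d e / 2"
    using t nz by (simp add: y_def dist_norm) (simp add: t_def)
  then have "y \<in> ball x d" "y \<in> ball x e" using d(1) e(1) by auto
  moreover have "y \<in> affine hull X"
  proof -
    have "y = (1 + t) *\<^sub>R x + (- t) *\<^sub>R z" by (simp add: y_def algebra_simps)
    then show ?thesis
      using mem_affine[OF affine_affine_hull, of x X z "1 + t" "- t"] xX z by (simp add: hull_inc)
  qed
  ultimately have "y \<in> X" "y \<notin> U" using e d by auto
  then obtain C where C: "C \<in> \<C>" "y \<in> C" "x \<in> C"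
    using Union_cover by (auto simp: U_def)
  have "x = (1 - 1 / (1 + t)) *\<^sub>R z + (1 / (1 + t)) *\<^sub>R y"
  proof -
    have "(1 + t) *\<^sub>R x = t *\<^sub>R z + y" by (simp add: y_def algebra_simps)
    then have "(1 / (1 + t)) *\<^sub>R ((1 + t) *\<^sub>R x) = (1 / (1 + t)) *\<^sub>R (t *\<^sub>R z + y)" by simp
    moreover have "1 - 1 / (1 + t) = t / (1 + t)" using t by (simp add: field_simps)
    ultimately show ?thesis using t by (simp add: scaleR_right_distrib)
  qed
  moreover have "z \<noteq> y"
  proof
    assume "z = y"
    then have "(1 + t) *\<^sub>R (x - z) = 0" by (simp add: y_def algebra_simps)
    then show False using t z by auto
  qed
  ultimately have "x \<in> open_segment z y"
    using t unfolding in_segment by (intro conjI exI[of _ "1 / (1 + t)"]) auto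
  then show thesis using that C by blast
qed

text \<open>
  A face \<open>F\<close> of a cell meeting the relative interior of \<open>X\<close> is the intersection \<open>K\<close> of all members
  of the cover through a point \<open>x\<close> of both relative interiors: a segment from a point of \<open>K\<close> to \<open>x\<close>
  can be prolonged inside a single member of the cover, which forces its end points into \<open>F\<close>.
\<close>

lemma face_of_cell:
  assumes P: "P \<in> cells" and F: "F face_of P" and meets: "F \<inter> rel_interior X \<noteq> {}"
  shows "F \<in> cells"
proof -
  have cF: "convex F" using F face_of_imp_convex by blast
  have FP: "F \<subseteq> P" using F face_of_imp_subset by blast
  have FX: "F \<subseteq> X" using FP cell_subset[OF P] by blast
  have "rel_interior F \<noteq> {}" using meets cF rel_interior_eq_empty by blast
  then obtain x where x: "x \<in> rel_interior F" by blast
  obtain u where u: "u \<in> F" "u \<in> rel_interior X" using meets by blast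
  \<comment> \<open>The segment from \<open>u\<close> to \<open>x\<close> can be prolonged to some
    \<open>v\<close> in \<open>F\<close>. Shrinking \<open>v\<close> towards the relative interior
    point \<open>u\<close> of \<open>X\<close> gives back \<open>x\<close>.\<close>
  have xX: "x \<in> rel_interior X"
  proof (cases "x = u")
    case False
    obtain e where e: "e > 1" "(1 - e) *\<^sub>R u + e *\<^sub>R x \<in> F"
      using x cF u convex_rel_interior_iff[of F x] by blast
    define v where "v = (1 - e) *\<^sub>R u + e *\<^sub>R x"
    have "v - u = e *\<^sub>R (x - u)" by (simp add: v_def algebra_simps)
    then have "(1 / e) *\<^sub>R (v - u) = x - u" using e by simp
    then have "v - (1 - 1 / e) *\<^sub>R (v - u) = x"
      by (simp add: scaleR_left_diff_distrib)
    moreover have "v - (1 - 1 / e) *\<^sub>R (v - u) \<in> rel_interior X \<or> e = 1"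
      using rel_interior_convex_shrink[OF convex_X u(2), of v "1 - 1 / e"] e FX v_def by auto
    ultimately show ?thesis using e by simp
  qed (use u in simp)
  have xF: "x \<in> F" using x rel_interior_subset by blast
  define K where "K = \<Inter>{C \<in> \<C>. x \<in> C}"
  have "{C \<in> \<C>. x \<in> C} \<noteq> {}" using xF FX Union_cover by auto
  moreover have "x \<in> K" by (auto simp: K_def)
  ultimately have K: "K \<in> cells" unfolding cells_def K_def by blast
  have KP: "K \<subseteq> P"
  proof -
    obtain \<D> where "\<D> \<subseteq> \<C>" "P = \<Inter>\<D>" using P by (auto elim!: cellE)
    then show ?thesis using xF FP unfolding K_def by blast
  qed
  have "K \<subseteq> F"
  proof
    fix z assume z: "z \<in> K"
    show "z \<in> F"
    proof (cases "z = x")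
      case False
      obtain C y where C: "C \<in> \<C>" "x \<in> C" "y \<in> C" "x \<in> open_segment z y"
        using extend_segment_in_cover[OF xX _ False] z cell_subset[OF K] by blast
      have "z \<in> C" using z C by (auto simp: K_def)
      \<comment> \<open>Two face arguments in turn: the face \<open>C \<inter> P\<close> of
        \<open>C\<close> contains \<open>x\<close>, hence also \<open>y\<close>. Only then is the
        whole segment known to lie in \<open>P\<close>, where the face \<open>F\<close>
        applies.\<close>
      then have "y \<in> P"
        using face_ofD[OF cover_Int_cell_face[OF P C(1)] C(4)] C xF FP by auto
      then show ?thesis
        using face_ofD[OF F C(4)] z KP xF by blast
    qed (use xF in simp)
  qed
  \<comment> \<open>A face of \<open>P\<close> that meets the relative interior of a subset of
    \<open>P\<close> contains that subset.\<close>
  moreover have "F \<subseteq> K"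
  proof (rule subset_of_face_of)
    show "K face_of P" using cell_Int_face[OF P K] KP by (simp add: Int_absorb1)
    show "K \<inter> rel_interior F \<noteq> {}" using x \<open>x \<in> K\<close> by blast
  qed (rule FP)
  ultimately show ?thesis using K by simp
qed

section \<open>Dimension of the cells\<close>

lemma low_dim_complement_dense:
  assumes "C \<subseteq> X" "aff_dim C < aff_dim X"
  shows "X \<subseteq> closure (X - C)"
proof
  fix x assume x: "x \<in> X"
  have "\<not> X \<subseteq> affine hull C"
  proof
    assume "X \<subseteq> affine hull C"
    then have "aff_dim X \<le> aff_dim C" using aff_dim_subset[of X "affine hull C"] by simp
    then show False using assms by simp
  qed
  then obtain z where z: "z \<in> X" "z \<notin> affine hull C" by blast
  show "x \<in> closure (X - C)"
  proof (cases "x \<in> affine hull C")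
    case True
    have "x \<noteq> z" using True z by blast
    \<comment> \<open>The line through \<open>x\<close> and \<open>z\<close> meets
      \<open>affine hull C\<close> only in \<open>x\<close>: a second common point would put
      \<open>z\<close> into the hull.\<close>
    have "open_segment x z \<subseteq> X - C"
    proof
      fix y assume y: "y \<in> open_segment x z"
      obtain t where t: "0 < t" "t < 1" and yt: "y = (1 - t) *\<^sub>R x + t *\<^sub>R z"
        using y unfolding in_segment by blast
      have "y \<in> X" unfolding yt using convex_X x z(1) t by (intro convexD_alt) simp_all
      moreover have "y \<notin> C"
      proof
        assume "y \<in> C"
        then have "y \<in> affine hull C" by (rule hull_inc)
        then have "(1 - 1 / t) *\<^sub>R x + (1 / t) *\<^sub>R y \<in> affine hull C"
          by (intro mem_affine[OF affine_affine_hull True]) simp_all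
        moreover have "(1 - 1 / t) *\<^sub>R x + (1 / t) *\<^sub>R y = x + (1 / t) *\<^sub>R (t *\<^sub>R (z - x))"
          unfolding yt by (simp only: algebra_simps scaleR_one)
        ultimately show False using z(2) t by simp
      qed
      ultimately show "y \<in> X - C" by blast
    qed
    then have "closure (open_segment x z) \<subseteq> closure (X - C)" by (rule closure_mono)
    moreover have "x \<in> closure (open_segment x z)"
      unfolding closure_open_segment using \<open>x \<noteq> z\<close> by simp
    ultimately show ?thesis by (rule subsetD)
  next
    case False
    then have "x \<in> X - C" using x hull_inc[of x C] by blast
    then show ?thesis by (rule subsetD[OF closure_subset])
  qed
qed

text \<open>By Baire, the complements in \<open>X\<close> of the finitely many lower-dimensional
  members have a common point. A member through that point must have full dimension.\<close>

lemma ex_full_dim: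
  obtains C where "C \<in> \<C>" "C \<noteq> {}" "aff_dim C = aff_dim X"
proof -
  \<comment> \<open>Inserting \<open>X\<close> keeps the intersection inside \<open>X\<close> even
    if there are no lower-dimensional members.\<close>
  define \<G> where "\<G> = insert X ((\<lambda>C. X - C) ` {C \<in> \<C>. aff_dim C < aff_dim X})"
  have "X \<subseteq> closure (\<Inter>\<G>)"
  proof (rule Baire[OF closed_X])
    show "countable \<G>" unfolding \<G>_def using finite_cover by (simp add: countable_finite)
    fix T assume T: "T \<in> \<G>"
    show "openin (top_of_set X) T \<and> X \<subseteq> closure T"
    proof (cases "T = X")
      case False
      then obtain C where C: "C \<in> \<C>" "aff_dim C < aff_dim X" "T = X - C"
        using T by (auto simp: \<G>_def)
      then have "C \<subseteq> X" "closed C"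
        using Union_cover polyhedron_cover polyhedron_imp_closed by auto
      then show ?thesis
        using C low_dim_complement_dense closed_subset[of C X] by (auto intro!: openin_diff)
    qed (use closure_subset in simp)
  qed
  then have "\<Inter>\<G> \<noteq> {}" using X_nonempty by auto
  then obtain x where x: "x \<in> \<Inter>\<G>" by blast
  then have "x \<in> X" by (simp add: \<G>_def)
  then obtain C where C: "C \<in> \<C>" "x \<in> C" using Union_cover by blast
  then have "\<not> aff_dim C < aff_dim X" using x unfolding \<G>_def by blast
  moreover have "aff_dim C \<le> aff_dim X" using C Union_cover by (intro aff_dim_subset) auto
  ultimately show thesis using that C by fastforce
qed

lemma complex_dim_cells: "complex_dim cells = aff_dim X"
  unfolding complex_dim_def
proof (rule Max_eqI)
  show "finite (aff_dim ` cells)" by (simp add: finite_cells)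
  show "d \<le> aff_dim X" if "d \<in> aff_dim ` cells" for d
    using that aff_dim_subset cell_subset by blast
  show "aff_dim X \<in> aff_dim ` cells"
  proof -
    obtain C where "C \<in> \<C>" "C \<noteq> {}" "aff_dim C = aff_dim X" by (rule ex_full_dim)
    then show ?thesis using cover_subset_cells[of C] image_eqI[of "aff_dim X" aff_dim C cells] by simp
  qed
qed

text \<open>A cell is a face of any member of the cover that contains it, and a proper face of a
  convex set has smaller dimension.\<close>

lemma full_dim_cell:
  assumes P: "P \<in> cells" and "aff_dim P = aff_dim X"
  shows "P \<in> \<C>"
proof -
  obtain \<D> C where D: "\<D> \<subseteq> \<C>" "P = \<Inter>\<D>" "C \<in> \<D>" "P \<noteq> {}"
    using P by (auto elim!: cellE)
  then have C: "C \<in> \<C>" "P \<subseteq> C" "C \<noteq> {}" by auto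
  have "P face_of C"
    using cover_Int_cell_face[OF P C(1,3)] C(2) by (simp add: Int_absorb1)
  moreover have "aff_dim C \<le> aff_dim P"
    using C Union_cover assms(2) aff_dim_subset[of C X] by auto
  moreover have "convex C" using C polyhedron_cover polyhedron_imp_convex by blast
  ultimately have "P = C" using face_of_aff_dim_lt[of C P] by linarith
  then show ?thesis using C by simp
qed

section \<open>The complex completed by faces\<close>

lemma with_faces_cells_eq: "with_faces cells = {F. \<exists>P\<in>cells. F face_of P}"
  unfolding with_faces_def using convex_cell face_of_refl by blast

lemma polyhedral_complex_with_faces_cells: "polyhedral_complex (with_faces cells)"
  unfolding polyhedral_complex_def
proof (intro conjI ballI allI impI)
  have "with_faces cells = (\<Union>P\<in>cells. {F. F face_of P})"
    unfolding with_faces_cells_eq by auto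
  then show "finite (with_faces cells)"
    using finite_cells finite_polyhedron_faces[OF polyhedron_cell] by simp
  show "polyhedron P" if "P \<in> with_faces cells" for P
    using that face_of_polyhedron_polyhedron polyhedron_cell unfolding with_faces_cells_eq by blast
  show "F \<in> with_faces cells" if "P \<in> with_faces cells" "F face_of P" for P F
    using that face_of_trans unfolding with_faces_cells_eq by blast
  have *: "(F \<inter> G) face_of F" if "F \<in> with_faces cells" "G \<in> with_faces cells" for F G
  proof -
    obtain P Q where PQ: "P \<in> cells" "F face_of P" "Q \<in> cells" "G face_of Q"
      using \<open>F \<in> with_faces cells\<close> \<open>G \<in> with_faces cells\<close> unfolding with_faces_cells_eq by blast
    \<comment> \<open>As \<open>P \<inter> Q\<close> is a face of \<open>P\<close>, so is
      \<open>F \<inter> G\<close>; being contained in \<open>F\<close>, it is then a face of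
      \<open>F\<close>.\<close>
    have "(F \<inter> G) face_of (P \<inter> Q)" using PQ face_of_Int_Int by blast
    then have "(F \<inter> G) face_of P" using PQ cell_Int_face face_of_trans by blast
    then show ?thesis using PQ face_of_subset face_of_imp_subset by (metis inf.cobounded1)
  qed
  show "(P \<inter> Q) face_of P" "(P \<inter> Q) face_of Q"
    if "P \<in> with_faces cells" "Q \<in> with_faces cells" for P Q
    using *[OF that] *[OF that(2,1)] by (simp_all add: Int_commute)
qed

text \<open>Contrapositive of \<open>face_of_cell\<close>: a face that meets the relative interior
  of \<open>X\<close> is already a cell.\<close>

lemma added_faces_subset_rel_frontier:
  assumes "F \<in> with_faces cells - cells"
  shows "F \<subseteq> rel_frontier X"
proof -
  obtain P where P: "P \<in> cells" "F face_of P" "F \<notin> cells"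
    using assms unfolding with_faces_cells_eq by blast
  have "F \<inter> rel_interior X = {}" using face_of_cell[OF P(1,2)] P(3) by blast
  moreover have "F \<subseteq> X" using face_of_imp_subset[OF P(2)] cell_subset[OF P(1)] by (rule subset_trans)
  ultimately show ?thesis using closed_X by (auto simp: rel_frontier_def)
qed

end


section \<open>The quadratic response\<close>

text \<open>Existence is the intermediate value theorem between \<open>Min (range V)\<close>, where
  the sum is 0, and a level at which a single summand already equals \<open>c\<close>. Here
  \<open>undefined\<close> merely names some index.\<close>

lemma ex1_multiplier:
  fixes V :: "'n::finite \<Rightarrow> real"
  assumes c: "c > 0"
  shows "\<exists>!l. (\<Sum>w\<in>UNIV. max 0 (l - V w)) = c"
proof -
  let ?g = "\<lambda>l. \<Sum>w\<in>UNIV. max 0 (l - V w)"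
  define a where "a = Min (range V)"
  have a: "a \<le> V w" for w by (simp add: a_def)
  have "?g a = 0" using a by (intro sum.neutral) simp
  moreover have "c \<le> ?g (V undefined + c)"
    using member_le_sum[of undefined UNIV "\<lambda>w. max 0 (V undefined + c - V w)"] c by simp
  ultimately have "\<exists>l\<ge>a. l \<le> V undefined + c \<and> ?g l = c"
    using a[of undefined] c by (intro IVT' continuous_intros) auto
  then obtain l where l: "?g l = c" by blast
  \<comment> \<open>The sum is constantly 0 for small \<open>l\<close>, so strict growth is claimed
    only from a point where its value is \<open>c > 0\<close>: there some summand is
    positive.\<close>
  have less: "?g l1 < ?g l2" if "l1 < l2" "?g l1 = c" for l1 l2
  proof (rule sum_strict_mono_ex1)
    obtain w where "l1 - V w > 0"
    proof -
      have "\<exists>w. l1 - V w > 0"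
      proof (rule ccontr)
        assume "\<nexists>w. l1 - V w > 0"
        then have "?g l1 = 0" by (intro sum.neutral) (simp add: not_less)
        then show False using \<open>?g l1 = c\<close> c by simp
      qed
      then show thesis using that by blast
    qed
    then show "\<exists>w\<in>UNIV. max 0 (l1 - V w) < max 0 (l2 - V w)"
      using \<open>l1 < l2\<close> by (intro bexI[of _ w]) auto
  qed (use that in auto)
  show ?thesis
  proof (rule ex1I[of _ l])
    show "l' = l" if "?g l' = c" for l'
      using less[OF _ l, of l'] less[OF _ that, of l] l that by (cases l' l rule: linorder_cases) auto
  qed (rule l)
qed

definition multiplier :: "real \<Rightarrow> ('n::finite \<Rightarrow> real) \<Rightarrow> real"
  where "multiplier c V = (THE l. (\<Sum>w\<in>UNIV. max 0 (l - V w)) = c)"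

lemma sum_multiplier: "c > 0 \<Longrightarrow> (\<Sum>w\<in>UNIV. max 0 (multiplier c V - V w)) = c"
  unfolding multiplier_def by (rule theI'[OF ex1_multiplier])

lemma multiplier_eqI: "c > 0 \<Longrightarrow> (\<Sum>w\<in>UNIV. max 0 (l - V w)) = c \<Longrightarrow> multiplier c V = l"
  using ex1_multiplier[of c V] sum_multiplier[of c V] by blast

text \<open>The constant \<open>2 / \<beta>\<close> makes the coordinates of the candidate
  \<open>z\<close> sum to 1. Strong convexity of the objective then gives minimality and uniqueness
  of \<open>z\<close> at once.\<close>

lemma quad_response_nth:
  fixes E :: "'s \<Rightarrow> 'w::finite \<Rightarrow> real^'h::finite"
  assumes \<beta>: "\<beta> > 0"
  shows "quad_response E R \<beta> x s $ w =
    \<beta> / 2 * max 0 (multiplier (2 / \<beta>) (disutility E R x s) - disutility E R x s w)"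
proof -
  define V where "V = disutility E R x s"
  define l where "l = multiplier (2 / \<beta>) V"
  define z where "z = (\<chi> w. \<beta> / 2 * max 0 (l - V w))"
  define f where "f = (\<lambda>y. \<Sum>w\<in>UNIV. V w * y $ w + 1 / \<beta> * (y $ w)\<^sup>2)"
  have "(\<Sum>w\<in>UNIV. z $ w) = 1"
    using sum_multiplier[of "2 / \<beta>" V] \<beta>
    by (simp add: z_def l_def flip: sum_distrib_left sum_divide_distrib)
  then have z: "z \<in> std_simplex" using \<beta> by (simp add: std_simplex_def z_def)
  have opt: "f z + (\<Sum>w\<in>UNIV. 1 / \<beta> * (y $ w - z $ w)\<^sup>2) \<le> f y" if y: "y \<in> std_simplex" for y
  proof -
    \<comment> \<open>The factor \<open>V w + 2 / \<beta> * z $ w\<close> is the partial derivative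
      of \<open>f\<close> at \<open>z\<close>: it equals \<open>l\<close> on the support of
      \<open>z\<close> and is at least \<open>l\<close> off it, where \<open>y $ w - z $ w\<close>
      is nonnegative.\<close>
    have "l * (y $ w - z $ w) \<le> (V w + 2 / \<beta> * z $ w) * (y $ w - z $ w)" for w
    proof (cases "V w < l")
      case True
      then have "V w + 2 / \<beta> * z $ w = l" using \<beta> by (simp add: z_def field_simps)
      then show ?thesis by simp
    next
      case False
      then have "z $ w = 0" by (simp add: z_def)
      then show ?thesis using False y by (simp add: std_simplex_def mult_right_mono)
    qed
    also have "(V w + 2 / \<beta> * z $ w) * (y $ w - z $ w) =
      (V w * y $ w + 1 / \<beta> * (y $ w)\<^sup>2) - (V w * z $ w + 1 / \<beta> * (z $ w)\<^sup>2)
        - 1 / \<beta> * (y $ w - z $ w)\<^sup>2" for w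
      using \<beta> by (simp add: field_simps power2_eq_square)
    finally have "(\<Sum>w\<in>UNIV. l * (y $ w - z $ w)) \<le>
      (\<Sum>w\<in>UNIV. (V w * y $ w + 1 / \<beta> * (y $ w)\<^sup>2) - (V w * z $ w + 1 / \<beta> * (z $ w)\<^sup>2)
        - 1 / \<beta> * (y $ w - z $ w)\<^sup>2)"
      by (intro sum_mono)
    moreover have "(\<Sum>w\<in>UNIV. l * (y $ w - z $ w)) = 0"
      using y z by (simp add: std_simplex_def sum_subtractf flip: sum_distrib_left)
    ultimately show ?thesis
      by (simp only: f_def sum_subtractf)
  qed
  have "is_arg_min f (\<lambda>y. y \<in> std_simplex) z"
    unfolding is_arg_min_linorder
  proof (intro conjI allI impI)
    fix y :: "real^'w option" assume y: "y \<in> std_simplex"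
    have "0 \<le> (\<Sum>w\<in>UNIV. 1 / \<beta> * (y $ w - z $ w)\<^sup>2)" using \<beta> by (intro sum_nonneg) simp
    then show "f z \<le> f y" using opt[OF y] by linarith
  qed (rule z)
  moreover have "y = z" if "is_arg_min f (\<lambda>y. y \<in> std_simplex) y" for y
  proof -
    have y: "y \<in> std_simplex" "f y \<le> f z" using that z by (auto simp: is_arg_min_linorder)
    then have "(\<Sum>w\<in>UNIV. 1 / \<beta> * (y $ w - z $ w)\<^sup>2) \<le> 0" using opt[OF y(1)] by linarith
    then have "(\<Sum>w\<in>UNIV. 1 / \<beta> * (y $ w - z $ w)\<^sup>2) = 0"
      using \<beta> by (intro antisym sum_nonneg) auto
    then show ?thesis using \<beta> by (simp add: sum_nonneg_eq_0_iff vec_eq_iff)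
  qed
  ultimately have "quad_response E R \<beta> x s = z"
    unfolding quad_response_def V_def[symmetric] f_def[symmetric] by (rule the_equality)
  then show ?thesis by (simp add: z_def l_def V_def)
qed

text \<open>For nonempty \<open>A\<close> this is the solution \<open>l\<close> of the linear
  equation \<open>(\<Sum>w\<in>A. l - V w) = c\<close>.\<close>

definition support_multiplier :: "real \<Rightarrow> 'n set \<Rightarrow> ('n::finite \<Rightarrow> real) \<Rightarrow> real"
  where "support_multiplier c A V = (c + sum V A) / card A"

text \<open>Only weak inequalities are demanded, so indices with \<open>V w = l\<close> may be in
  \<open>A\<close> or not. This is what lets one point belong to the closed regions of several
  patterns.\<close>

lemma sum_over_support:
  fixes V :: "'n::finite \<Rightarrow> real" and l :: real
  assumes "\<forall>w\<in>A. V w \<le> l" "\<forall>w. w \<notin> A \<longrightarrow> l \<le> V w"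
  shows "(\<Sum>w\<in>UNIV. max 0 (l - V w)) = card A * l - sum V A"
proof -
  have "(\<Sum>w\<in>UNIV. max 0 (l - V w)) = (\<Sum>w\<in>A. l - V w)"
    using assms by (intro sum.mono_neutral_cong_right) auto
  then show ?thesis by (simp add: sum_subtractf)
qed

lemma multiplier_eq_support:
  assumes "c > 0" "A \<noteq> {}"
    and "\<forall>w\<in>A. V w \<le> support_multiplier c A V" "\<forall>w. w \<notin> A \<longrightarrow> support_multiplier c A V \<le> V w"
  shows "multiplier c V = support_multiplier c A V"
  using assms sum_over_support[OF assms(3,4)]
  by (intro multiplier_eqI) (simp_all add: support_multiplier_def)

lemma support_eq_multiplier:
  assumes "c > 0"
    and "\<forall>w\<in>A. V w \<le> multiplier c V" "\<forall>w. w \<notin> A \<longrightarrow> multiplier c V \<le> V w"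
  shows "A \<noteq> {}" "support_multiplier c A V = multiplier c V"
proof -
  have *: "c = card A * multiplier c V - sum V A"
    using sum_over_support[OF assms(2,3)] sum_multiplier[OF assms(1), of V] by simp
  then show "A \<noteq> {}" using assms(1) by auto
  then have "card A \<noteq> 0" by simp
  then show "support_multiplier c A V = multiplier c V"
    unfolding support_multiplier_def by (subst *) (simp add: field_simps)
qed



section \<open>Pattern regions\<close>

lemma affine_nonpos_polyhedron:
  fixes f :: "'a::euclidean_space \<Rightarrow> real"
  assumes "\<And>x. f x = a \<bullet> x + b"
  shows "polyhedron {x. f x \<le> 0}"
proof -
  have "{x. f x \<le> 0} = {x. a \<bullet> x \<le> - b}" unfolding assms by (intro Collect_cong) linarith
  then show ?thesis by (simp add: polyhedron_halfspace_le)
qed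

lemma affine_zero_face_of:
  fixes f :: "'a::euclidean_space \<Rightarrow> real"
  assumes f: "\<And>x. f x = a \<bullet> x + b" and S: "convex S" "(\<forall>x\<in>S. f x \<le> 0) \<or> (\<forall>x\<in>S. 0 \<le> f x)"
  shows "S \<inter> {x. f x = 0} face_of S"
proof -
  have eq: "{x. f x = 0} = {x. a \<bullet> x = - b}" unfolding f by (intro Collect_cong) linarith
  from S(2) show ?thesis
  proof
    assume "\<forall>x\<in>S. f x \<le> 0"
    then have "a \<bullet> x \<le> - b" if "x \<in> S" for x using that unfolding f by force
    then show ?thesis unfolding eq by (rule face_of_Int_supporting_hyperplane_le[OF S(1)])
  next
    assume "\<forall>x\<in>S. 0 \<le> f x"
    then have "a \<bullet> x \<ge> - b" if "x \<in> S" for x using that unfolding f by force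
    then show ?thesis unfolding eq by (rule face_of_Int_supporting_hyperplane_ge[OF S(1)])
  qed
qed

context
  fixes E :: "'s::finite \<Rightarrow> 'w::finite \<Rightarrow> real^'h::finite"
    and R :: "'s \<Rightarrow> 'w \<Rightarrow> real"
    and X :: "(real^'h^'w) set"
    and \<beta> :: real
  assumes X: "polytope X" and \<beta>: "\<beta> > 0"
begin

abbreviation (input) "V x s \<equiv> disutility E R x s"
abbreviation (input) "lam x s \<equiv> multiplier (2 / \<beta>) (V x s)"
abbreviation (input) "region A \<equiv> pattern_region E R X \<beta> A"

text \<open>
  For the fixed support prescribed by \<open>A\<close>, the multiplier is an affine function of \<open>x\<close>, and so is
  \<open>gap\<close>. Rows of \<open>A\<close> without support make \<open>gap\<close> meaningless (division by 0), but they do not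
  occur in feasible patterns.
\<close>

definition gap :: "('s, 'w) pattern \<Rightarrow> 's \<Rightarrow> 'w option \<Rightarrow> real^'h^'w \<Rightarrow> real"
  where "gap A s w x = V x s w - support_multiplier (2 / \<beta>) {v. A s v} (V x s)"

text \<open>Written with \<open>gap\<close> rather than with the true multiplier, so that every
  constraint is affine in \<open>x\<close>.\<close>

definition closed_region :: "('s, 'w) pattern \<Rightarrow> (real^'h^'w) set"
  where "closed_region A = {x \<in> X. \<forall>s w. (A s w \<longrightarrow> gap A s w x \<le> 0) \<and> (\<not> A s w \<longrightarrow> 0 \<le> gap A s w x)}"

lemma disutility_affine: "\<exists>a b. \<forall>x. V x s w = a \<bullet> x + b"
proof (cases w)
  case None
  then have "\<forall>x. V x s w = 0 \<bullet> x + 0" by (simp add: disutility_def)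
  then show ?thesis by blast
next
  case (Some v)
  then have "\<forall>x. V x s w = axis v (E s v) \<bullet> x + (- R s v)"
    by (simp add: disutility_def inner_axis')
  then show ?thesis by blast
qed

lemma gap_affine: "\<exists>a b. \<forall>x. gap A s w x = a \<bullet> x + b"
proof -
  obtain a b where V: "\<And>v x. V x s v = a v \<bullet> x + b v"
    using disutility_affine[of s] by metis
  define S where "S = {v. A s v}"
  have "gap A s w x = (a w - (1 / card S) *\<^sub>R sum a S) \<bullet> x + (b w - (2 / \<beta> + sum b S) / card S)" for x
    unfolding gap_def support_multiplier_def S_def[symmetric] V
    by (simp add: inner_diff_left inner_sum_left sum.distrib add_divide_distrib)
  then show ?thesis by blast
qed

lemma gap_segment: "gap A s w ((1 - t) *\<^sub>R x + t *\<^sub>R y) = (1 - t) * gap A s w x + t * gap A s w y"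
proof -
  obtain a b where "\<And>x. gap A s w x = a \<bullet> x + b" using gap_affine by metis
  then show ?thesis by (simp add: inner_add_right algebra_simps)
qed

lemma pattern_region_iff: "x \<in> region A \<longleftrightarrow> x \<in> X \<and> (\<forall>s w. V x s w < lam x s \<longleftrightarrow> A s w)"
  using \<beta> by (simp add: pattern_region_def quad_response_nth zero_less_mult_iff less_max_iff_disj)

lemma pattern_region_ineqs:
  assumes "x \<in> region A"
  shows "A s w \<Longrightarrow> V x s w \<le> lam x s" "\<not> A s w \<Longrightarrow> lam x s \<le> V x s w"
  using assms by (meson pattern_region_iff less_imp_le not_less)+

lemma gap_eq:
  assumes "\<And>w. A s w \<Longrightarrow> V x s w \<le> lam x s" "\<And>w. \<not> A s w \<Longrightarrow> lam x s \<le> V x s w"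
  shows "gap A s w x = V x s w - lam x s"
proof -
  have "support_multiplier (2 / \<beta>) {v. A s v} (V x s) = lam x s"
    using \<beta> assms by (intro support_eq_multiplier(2)) simp_all
  then show ?thesis by (simp add: gap_def)
qed

lemma row_nonempty:
  assumes "x \<in> region A"
  shows "{w. A s w} \<noteq> {}"
  using assms \<beta> pattern_region_ineqs[OF assms]
  by (intro support_eq_multiplier(1)[of "2 / \<beta>" _ "V x s"]) auto

text \<open>The constraints make the support multiplier solve the equation of the true one, which
  has a unique solution. The nonempty region serves to make every row of \<open>A\<close>
  nonempty.\<close>

lemma gap_eq_closed_region:
  assumes "region A \<noteq> {}" "x \<in> closed_region A"
  shows "gap A s w x = V x s w - lam x s"
proof -
  have "lam x s = support_multiplier (2 / \<beta>) {v. A s v} (V x s)"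
    using assms row_nonempty \<beta>
    by (intro multiplier_eq_support) (auto simp: closed_region_def gap_def split: if_splits)
  then show ?thesis by (simp add: gap_def)
qed

text \<open>The multiplier on the right does not depend on \<open>A\<close>, which makes the regions
  of two patterns comparable.\<close>

lemma closed_region_iff:
  assumes "region A \<noteq> {}"
  shows "x \<in> closed_region A \<longleftrightarrow>
    x \<in> X \<and> (\<forall>s w. (A s w \<longrightarrow> V x s w \<le> lam x s) \<and> (\<not> A s w \<longrightarrow> lam x s \<le> V x s w))"
proof
  assume x: "x \<in> closed_region A"
  then show "x \<in> X \<and> (\<forall>s w. (A s w \<longrightarrow> V x s w \<le> lam x s) \<and> (\<not> A s w \<longrightarrow> lam x s \<le> V x s w))"
    using gap_eq_closed_region[OF assms x] by (simp add: closed_region_def)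
next
  assume x: "x \<in> X \<and> (\<forall>s w. (A s w \<longrightarrow> V x s w \<le> lam x s) \<and> (\<not> A s w \<longrightarrow> lam x s \<le> V x s w))"
  then have "gap A s w x = V x s w - lam x s" for s w by (intro gap_eq) blast+
  then show "x \<in> closed_region A" using x by (auto simp: closed_region_def)
qed

lemma pattern_region_iff_gap:
  assumes "region A \<noteq> {}"
  shows "x \<in> region A \<longleftrightarrow> x \<in> X \<and> (\<forall>s w. gap A s w x < 0 \<longleftrightarrow> A s w)"
proof
  assume x: "x \<in> region A"
  then have "gap A s w x = V x s w - lam x s" for s w
    by (intro gap_eq pattern_region_ineqs)
  then show "x \<in> X \<and> (\<forall>s w. gap A s w x < 0 \<longleftrightarrow> A s w)" using x by (simp add: pattern_region_iff)
next
  assume x: "x \<in> X \<and> (\<forall>s w. gap A s w x < 0 \<longleftrightarrow> A s w)"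
  then have "(A s w \<longrightarrow> gap A s w x \<le> 0) \<and> (\<not> A s w \<longrightarrow> 0 \<le> gap A s w x)" for s w
    by (meson less_imp_le not_less)
  then have "x \<in> closed_region A" using x by (simp add: closed_region_def)
  then have "gap A s w x = V x s w - lam x s" for s w by (rule gap_eq_closed_region[OF assms])
  then show "x \<in> region A" using x by (simp add: pattern_region_iff)
qed

lemma polyhedron_closed_region: "polyhedron (closed_region A)"
proof -
  define H where "H p = {x. (A (fst p) (snd p) \<longrightarrow> gap A (fst p) (snd p) x \<le> 0) \<and>
    (\<not> A (fst p) (snd p) \<longrightarrow> 0 \<le> gap A (fst p) (snd p) x)}" for p
  have "closed_region A = X \<inter> \<Inter>(range H)" by (auto simp: closed_region_def H_def)
  moreover have "polyhedron (H p)" for p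
  proof -
    obtain a b where ab: "\<And>x. gap A (fst p) (snd p) x = a \<bullet> x + b" using gap_affine by metis
    show ?thesis
    proof (cases "A (fst p) (snd p)")
      case True
      then show ?thesis using affine_nonpos_polyhedron[OF ab] by (simp add: H_def)
    next
      case False
      have "- gap A (fst p) (snd p) x = (- a) \<bullet> x + (- b)" for x by (simp add: ab)
      from affine_nonpos_polyhedron[OF this] show ?thesis using False by (simp add: H_def)
    qed
  qed
  then have "polyhedron (\<Inter>(range H))" by (intro polyhedron_Inter) auto
  ultimately show ?thesis using X by (simp add: polytope_imp_polyhedron)
qed

text \<open>Along a segment from \<open>x\<close> in the closed region to \<open>z\<close> in the
  region every \<open>gap\<close> is affine. On the support it is negative at \<open>z\<close>,
  hence negative on the open segment; off the support it stays nonnegative. So \<open>x\<close> is a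
  limit of points of the region.\<close>

lemma closure_pattern_region:
  assumes "region A \<noteq> {}"
  shows "closure (region A) = closed_region A"
proof
  have "region A \<subseteq> closed_region A"
  proof
    fix x assume x: "x \<in> region A"
    then have "x \<in> X" by (simp add: pattern_region_iff)
    then show "x \<in> closed_region A"
      using pattern_region_ineqs[OF x] by (simp add: closed_region_iff[OF assms])
  qed
  then show "closure (region A) \<subseteq> closed_region A"
    by (intro closure_minimal polyhedron_imp_closed polyhedron_closed_region)
  obtain z where z: "z \<in> region A" using assms by blast
  have zgap: "gap A s w z < 0 \<longleftrightarrow> A s w" for s w using z pattern_region_iff_gap[OF assms] by blast
  show "closed_region A \<subseteq> closure (region A)"
  proof
    fix x assume x: "x \<in> closed_region A"
    show "x \<in> closure (region A)"
    proof (cases "x = z")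
      case True
      then show ?thesis using z closure_subset by blast
    next
      case False
      have "open_segment x z \<subseteq> region A"
      proof
        fix y assume "y \<in> open_segment x z"
        then obtain t where t: "0 < t" "t < 1" and y: "y = (1 - t) *\<^sub>R x + t *\<^sub>R z"
          unfolding in_segment by blast
        have "x \<in> X" "z \<in> X" using x z by (auto simp: closed_region_def pattern_region_iff)
        then have "y \<in> X" unfolding y using t X by (intro convexD_alt) (auto simp: polytope_imp_convex)
        moreover have "gap A s w y < 0 \<longleftrightarrow> A s w" for s w
        proof (cases "A s w")
          case True
          then have "(1 - t) * gap A s w x \<le> 0" "t * gap A s w z < 0"
            using x t zgap by (auto simp: closed_region_def mult_le_0_iff mult_less_0_iff)
          then show ?thesis using True unfolding y gap_segment by simp
        next
          case False
          then have "0 \<le> (1 - t) * gap A s w x" "0 \<le> t * gap A s w z"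
            using x t zgap[of s w] by (auto simp: closed_region_def)
          then show ?thesis using False unfolding y gap_segment by simp
        qed
        ultimately show "y \<in> region A" by (simp add: pattern_region_iff_gap[OF assms])
      qed
      then have "closure (open_segment x z) \<subseteq> closure (region A)" by (rule closure_mono)
      moreover have "x \<in> closure (open_segment x z)"
        unfolding closure_open_segment using False by simp
      ultimately show ?thesis by (rule subsetD)
    qed
  qed
qed

text \<open>
  On both regions \<open>gap\<close> is measured against the same true multiplier, so they meet exactly where
  the supporting constraints on which their patterns differ are tight.
\<close>

lemma closed_region_Int_face_of:
  assumes A: "region A \<noteq> {}" and B: "region B \<noteq> {}"
  shows "closed_region A \<inter> closed_region B face_of closed_region A"
proof -
  \<comment> \<open>The first entry keeps the family nonempty when the patterns agree
    everywhere.\<close>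
  define \<F> where "\<F> = insert (closed_region A)
    {closed_region A \<inter> {x. gap A s w x = 0} |s w. A s w \<noteq> B s w}"
  have cv: "convex (closed_region A)"
    by (simp add: polyhedron_closed_region polyhedron_imp_convex)
  have "\<Inter>\<F> face_of closed_region A"
  proof (rule face_of_Inter)
    fix T assume "T \<in> \<F>"
    then consider "T = closed_region A" | s w where "T = closed_region A \<inter> {x. gap A s w x = 0}"
      unfolding \<F>_def by blast
    then show "T face_of closed_region A"
    proof cases
      case 2
      obtain a b where ab: "\<And>x. gap A s w x = a \<bullet> x + b" using gap_affine by metis
      show ?thesis unfolding 2
        by (rule affine_zero_face_of[OF ab cv]) (cases "A s w", auto simp: closed_region_def)
    qed (simp add: cv face_of_refl)
  qed (simp add: \<F>_def)
  moreover have "x \<in> \<Inter>\<F> \<longleftrightarrow> x \<in> closed_region A \<inter> closed_region B" for x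
  proof -
    have "x \<in> \<Inter>\<F> \<longleftrightarrow> x \<in> closed_region A \<and> (\<forall>s w. A s w \<noteq> B s w \<longrightarrow> gap A s w x = 0)"
      unfolding \<F>_def by blast
    also have "\<dots> \<longleftrightarrow> x \<in> closed_region A \<and> (\<forall>s w. A s w \<noteq> B s w \<longrightarrow> V x s w = lam x s)"
      using gap_eq_closed_region[OF A] by auto
    \<comment> \<open>Where the patterns differ, they impose opposite inequalities, which together
      say equality; where they agree, the constraints coincide.\<close>
    also have "\<dots> \<longleftrightarrow> x \<in> closed_region A \<inter> closed_region B"
      unfolding Int_iff closed_region_iff[OF A] closed_region_iff[OF B]
      by (auto intro: order.antisym) (metis order.refl)+
    finally show ?thesis .
  qed
  ultimately show ?thesis by (metis subsetI subset_antisym)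
qed


section \<open>The regions as a face-to-face cover\<close>

definition regions :: "(real^'h^'w) set set"
  where "regions = (\<lambda>A. closure (region A)) ` feasible_patterns E R X \<beta>"

lemma feasible_patterns_iff: "A \<in> feasible_patterns E R X \<beta> \<longleftrightarrow> region A \<noteq> {}"
  by (simp add: feasible_patterns_def)

lemma regionsE:
  assumes "C \<in> regions"
  obtains A where "region A \<noteq> {}" "C = closed_region A"
proof -
  obtain A where "region A \<noteq> {}" "C = closure (region A)"
    using assms by (auto simp: regions_def feasible_patterns_iff)
  then show thesis using that closure_pattern_region by simp
qed

text \<open>Each point of \<open>X\<close> lies in the region of the pattern that its own response
  defines.\<close>

lemma Union_regions: "\<Union>regions = X"
proof
  show "\<Union>regions \<subseteq> X"
    by (auto elim!: regionsE simp: closed_region_def)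
  show "X \<subseteq> \<Union>regions"
  proof
    fix x assume x: "x \<in> X"
    define A where "A s w \<longleftrightarrow> V x s w < lam x s" for s w
    have "x \<in> region A" using x by (simp add: pattern_region_iff A_def)
    then have "A \<in> feasible_patterns E R X \<beta>" "x \<in> closure (region A)"
      using feasible_patterns_iff closure_subset by blast+
    then show "x \<in> \<Union>regions" unfolding regions_def by blast
  qed
qed

lemma face_to_face_regions:
  assumes "X \<noteq> {}"
  shows "face_to_face_cover X regions"
proof
  have "finite (UNIV :: ('s, 'w) pattern set)" by simp
  then show "finite regions" unfolding regions_def by (meson finite_imageI finite_subset subset_UNIV)
  show "\<Union>regions = X" by (rule Union_regions)
  show "polyhedron C" if "C \<in> regions" for C
    using that polyhedron_closed_region by (auto elim!: regionsE)
  show "C \<inter> D face_of C" if "C \<in> regions" "D \<in> regions" for C D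
    using that closed_region_Int_face_of by (metis regionsE)
  show "convex X" "closed X" using X by (simp_all add: polytope_imp_convex polytope_imp_closed)
qed (rule assms)

text \<open>Passes between indexed intersections and subfamilies: a finite subfamily is enumerated
  by \<open>{1..card \<D>}\<close>, and a pattern is chosen for each of its members.\<close>

lemma price_cells_eq:
  assumes "X \<noteq> {}"
  shows "price_cells E R X \<beta> = face_to_face_cover.cells regions"
proof -
  interpret face_to_face_cover X regions using assms by (rule face_to_face_regions)
  have "P \<in> cells" if P: "P \<in> price_cells E R X \<beta>" for P
  proof -
    obtain k A where k: "1 \<le> (k::nat)" "\<forall>i\<in>{1..k}. A i \<in> feasible_patterns E R X \<beta>"
      "P = (\<Inter>i\<in>{1..k}. closure (region (A i)))" "P \<noteq> {}"
      using P unfolding price_cells_def by blast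
    have "(\<lambda>i. closure (region (A i))) ` {1..k} \<noteq> {}" using k(1) by simp
    moreover have "(\<lambda>i. closure (region (A i))) ` {1..k} \<subseteq> regions"
      using k(2) unfolding regions_def by blast
    ultimately have "\<exists>\<D>. \<D> \<noteq> {} \<and> \<D> \<subseteq> regions \<and> P = \<Inter>\<D>" using k(3) by (intro exI conjI)
    then show ?thesis using k(4) by (simp add: cells_def)
  qed
  moreover have "P \<in> price_cells E R X \<beta>" if P: "P \<in> cells" for P
  proof -
    obtain \<D> where D: "\<D> \<noteq> {}" "\<D> \<subseteq> regions" "P = \<Inter>\<D>" "P \<noteq> {}" using P by (rule cellE)
    have "finite \<D>" using D(2) finite_cover by (rule finite_subset)
    then obtain g where "bij_betw g {1..card \<D>} \<D>" by (rule ex_bij_betw_nat_finite_1[THEN exE])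
    then have gi: "g ` {1..card \<D>} = \<D>" by (rule bij_betw_imp_surj_on)
    have "\<forall>i\<in>{1..card \<D>}. \<exists>A. A \<in> feasible_patterns E R X \<beta> \<and> g i = closure (region A)"
    proof
      fix i assume "i \<in> {1..card \<D>}"
      then have "g i \<in> regions" using gi D(2) by blast
      then show "\<exists>A. A \<in> feasible_patterns E R X \<beta> \<and> g i = closure (region A)"
        unfolding regions_def by blast
    qed
    then obtain A where A: "\<forall>i\<in>{1..card \<D>}. A i \<in> feasible_patterns E R X \<beta> \<and>
        g i = closure (region (A i))"
      by (rule bchoice[THEN exE])
    then have "(\<Inter>i\<in>{1..card \<D>}. closure (region (A i))) = \<Inter>(g ` {1..card \<D>})"
      by (intro INF_cong) auto
    then have "P = (\<Inter>i\<in>{1..card \<D>}. closure (region (A i)))" by (simp only: D(3) gi)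
    moreover have "1 \<le> card \<D>" using \<open>finite \<D>\<close> D(1) by (simp add: Suc_le_eq card_gt_0_iff)
    moreover have "P \<subseteq> X" using P by (rule cell_subset)
    ultimately have "\<exists>(k::nat) A. 1 \<le> k \<and> (\<forall>i\<in>{1..k}. A i \<in> feasible_patterns E R X \<beta>) \<and>
        P = (\<Inter>i\<in>{1..k}. closure (region (A i)))"
      using A by (intro exI[of _ "card \<D>"] exI[of _ A] conjI ballI) blast+
    then show ?thesis using \<open>P \<subseteq> X\<close> D(4) by (simp add: price_cells_def)
  qed
  ultimately show ?thesis by blast
qed

end

theorem theorem3p9:
  fixes E :: "'s::finite \<Rightarrow> 'w::finite \<Rightarrow> real^'h::finite"
    and R :: "'s \<Rightarrow> 'w \<Rightarrow> real"
    and X :: "(real^'h^'w) set"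
    and \<beta> :: real
  assumes "CARD('h) > 1"
    and "polytope X" and "X \<noteq> {}"
    and "\<forall>s w h. 0 \<le> E s w $ h"
    and "\<beta> > 0"
  shows "polyhedral_complex (with_faces (price_cells E R X \<beta>)) \<and>
         (\<forall>F \<in> with_faces (price_cells E R X \<beta>) - price_cells E R X \<beta>. F \<subseteq> rel_frontier X) \<and>
         complex_dim (price_cells E R X \<beta>) = aff_dim X \<and>
         (\<forall>P \<in> price_cells E R X \<beta>. aff_dim P = aff_dim X \<longrightarrow>
            (\<exists>A \<in> feasible_patterns E R X \<beta>. P = closure (pattern_region E R X \<beta> A)))"
proof -
  interpret face_to_face_cover X "regions E R X \<beta>"
    using assms by (intro face_to_face_regions)
  have cells: "price_cells E R X \<beta> = cells"
    using assms by (intro price_cells_eq)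
  show ?thesis
    unfolding cells
  proof (intro conjI ballI impI)
    show "\<exists>A\<in>feasible_patterns E R X \<beta>. P = closure (pattern_region E R X \<beta> A)"
      if "P \<in> cells" "aff_dim P = aff_dim X" for P
      using full_dim_cell[OF that] unfolding regions_def[OF assms(2,5)] by blast
  qed (rule polyhedral_complex_with_faces_cells added_faces_subset_rel_frontier complex_dim_cells,
      assumption?)+
qed

end
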